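(* Let $S$ be a preordered semiring of characteristic zero satisfying $1 \geq 0$, and let $u \in S$ be a polynomially universal element. Then for all nonzero $x, y \in S$, the following are equivalent: (1) $f(x) \geq f(y)$ for every monotone semiring homomorphism $f : S \to \mathbb{R}_+$. (2) For every $r \in \mathbb{R}_+$ and $\varepsilon > 0$, there exist a polynomial $p \in \mathbb{N}[X]$, a nonzero element $z \in S$ and $m \in \mathbb{N}_{>0}$ such that $p(r) \leq \varepsilon m$ and $m\, z\, x + p(u)\, z \geq m\, z\, y$. (3) For every $r \in \mathbb{R}_+$ and $\varepsilon > 0$, there exist a polynomial $p \in \mathbb{N}[X]$, a nonzero element $z \in S$ and $m \in \mathbb{N}_{>0}$ such that $p(r) \leq (1+\varepsilon) m$ and $p(u)\, z\, x \geq m\, z\, y$. (4) For every $r \in \mathbb{R}_+$ and $\varepsilon > 0$, there exist a polynomial $p \in \mathbb{N}[X]$ and $n, m \in \mathbb{N}_{>0}$ such that $p(r) \leq (1+\varepsilon)^n m$ and $p(u)\, x^n \geq m\, y^n$.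
   Context: A semiring is a set with two commutative monoid structures, addition (neutral element $0$) and multiplication (neutral element $1$), with multiplication distributing over addition; a semiring homomorphism preserves $+$, $\cdot$, $0$ and $1$. A semiring $S$ has characteristic zero if the unique semiring homomorphism $\mathbb{N} \to S$ is injective. A preordered semiring is a semiring $S$ with a preorder $\geq$ such that $x \geq y$ implies $x + z \geq y + z$ and $xz \geq yz$ for all $z \in S$. A semiring homomorphism $f: S \to T$ between preordered semirings is monotone if $x \geq y$ implies $f(x) \geq f(y)$; $\mathbb{R}_+$ carries its usual order. For a preordered semiring $S$ with $1 \geq 0$, an element $u \in S$ with $u \geq 1$ is polynomially universal if for every nonzero $x \in S$ there is a polynomial $p \in \mathbb{N}[X]$ with $p(u)\,x \geq 1$ and $p(u) \geq x$. Here $\mathbb{N} = \{0,1,2,\dots\}$ and $\mathbb{N}_{>0}$ denotes the positive integers; for $p \in \mathbb{N}[X]$, $p(u)$ denotes evaluation in $S$ and $p(r)$ evaluation at the real number $r$. *)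

theory Defs
  imports Complex_Main "HOL-Computational_Algebra.Polynomial"
begin

definition preordered_semiring :: "('a::comm_semiring_1 \<Rightarrow> 'a \<Rightarrow> bool) \<Rightarrow> bool" where
  "preordered_semiring ge \<longleftrightarrow>
     (\<forall>x. ge x x) \<and> (\<forall>x y z. ge x y \<longrightarrow> ge y z \<longrightarrow> ge x z) \<and>
     (\<forall>x y z. ge x y \<longrightarrow> ge (x + z) (y + z) \<and> ge (x * z) (y * z))"

definition char_zero_semiring :: "'a::comm_semiring_1 itself \<Rightarrow> bool" where
  "char_zero_semiring _ \<longleftrightarrow> inj (of_nat :: nat \<Rightarrow> 'a)"

definition peval :: "nat poly \<Rightarrow> 'a::comm_semiring_1 \<Rightarrow> 'a" where
  "peval p a = poly (map_poly of_nat p) a"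

definition poly_universal :: "('a::comm_semiring_1 \<Rightarrow> 'a \<Rightarrow> bool) \<Rightarrow> 'a \<Rightarrow> bool" where
  "poly_universal ge u \<longleftrightarrow> ge u 1 \<and>
     (\<forall>x. x \<noteq> 0 \<longrightarrow> (\<exists>p::nat poly. ge (peval p u * x) 1 \<and> ge (peval p u) x))"

definition monotone_hom_Rplus :: "('a::comm_semiring_1 \<Rightarrow> 'a \<Rightarrow> bool) \<Rightarrow> ('a \<Rightarrow> real) \<Rightarrow> bool" where
  "monotone_hom_Rplus ge f \<longleftrightarrow>
     (\<forall>x. f x \<ge> 0) \<and> f 0 = 0 \<and> f 1 = 1 \<and>
     (\<forall>x y. f (x + y) = f x + f y) \<and> (\<forall>x y. f (x * y) = f x * f y) \<and>
     (\<forall>x y. ge x y \<longrightarrow> f x \<ge> f y)"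

end

theory Submission
  imports Defs
begin

text \<open>
  Fix \<open>r \<ge> 0\<close> and let \<open>a \<ge>\<^sub>r b\<close> mean that (2) holds at \<open>r\<close> for the pair \<open>(a, b)\<close>. This is again
  a semiring preorder, and \<open>u \<le>\<^sub>r k\<close> for every natural \<open>k > r\<close>, because \<open>z = \<Sum>\<^bsub>i\<le>N\<^esub> k\<^bsup>N-i\<^esup> u\<^bsup>i\<^esup>\<close>
  satisfies \<open>u z \<le> k z + u\<^bsup>N+1\<^esup>\<close> while \<open>z \<ge> k\<^bsup>N\<^esup>\<close>. So polynomial bounds in \<open>u\<close> become bounds by
  natural numbers, which is Strassen's Archimedean setting. If \<open>x \<ge>\<^sub>r y\<close> fails, one may
  impose \<open>k y \<ge> k x + 2\<close> for some \<open>k > 0\<close> without ever getting \<open>e \<ge> e + 1\<close>; a maximal such extension is total,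
  and comparing elements with fractions of natural numbers yields a homomorphism
  \<open>f\<close> with \<open>f x < f y\<close>. Hence (1) implies (2); (2) gives (3) by absorbing \<open>1 \<le> q(u) x\<close>, and
  (3) gives (4) by iterating and bounding \<open>z\<close> from both sides by polynomials in \<open>u\<close>.
\<close>

section \<open>Evaluation of polynomials with natural coefficients\<close>

lemma peval_0 [simp]: "peval 0 a = 0"
  by (simp add: peval_def)

lemma peval_pCons [simp]: "peval (pCons c p) a = of_nat c + a * peval p a"
  by (simp add: peval_def map_poly_pCons)

lemma peval_add [simp]: "peval (p + q) a = peval p a + peval q a"
  by (induction p q rule: poly_induct2) (simp_all add: algebra_simps)

lemma peval_smult [simp]: "peval (smult c p) a = of_nat c * peval p a"
  by (induction p) (simp_all add: algebra_simps)

lemma peval_mult [simp]: "peval (p * q) a = peval p a * peval q a"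
  by (induction p) (simp_all add: algebra_simps)

lemma peval_1 [simp]: "peval 1 a = 1"
  by (simp add: one_pCons)

lemma peval_power [simp]: "peval (p ^ n) a = peval p a ^ n"
  by (induction n) simp_all

lemma peval_nonneg: "0 \<le> r \<Longrightarrow> 0 \<le> peval p (r::real)"
  by (induction p) simp_all

lemma monotone_hom_eval:
  assumes "monotone_hom_Rplus ge f"
  shows "f 0 = 0" "f 1 = 1" "f (a + b) = f a + f b" "f (a * b) = f a * f b" "f (of_nat n) = real n"
    "f (a ^ n) = f a ^ n" "f (peval p a) = peval p (f a)"
proof -
  have 0: "f 0 = 0" and 1: "f 1 = 1" and add: "\<And>a b. f (a + b) = f a + f b"
    and mult: "\<And>a b. f (a * b) = f a * f b"
    using assms by (auto simp: monotone_hom_Rplus_def)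
  have of_nat: "f (of_nat n) = real n" for n
    by (induction n) (simp_all add: 0 1 add)
  show "f 0 = 0" "f 1 = 1" "f (a + b) = f a + f b" "f (a * b) = f a * f b" "f (of_nat n) = real n"
    by (rule 0 1 add mult of_nat)+
  show "f (a ^ n) = f a ^ n"
    by (induction n) (simp_all add: 1 mult)
  show "f (peval p a) = peval p (f a)"
    by (induction p) (simp_all add: 0 add mult of_nat)
qed

lemma monotone_hom_mono: "monotone_hom_Rplus ge f \<Longrightarrow> ge a b \<Longrightarrow> f b \<le> f a"
  by (simp add: monotone_hom_Rplus_def)

lemma monotone_hom_nonneg: "monotone_hom_Rplus ge f \<Longrightarrow> 0 \<le> f a"
  by (simp add: monotone_hom_Rplus_def)

section \<open>Nonnegative semiring preorders\<close>

locale nonneg_preorder =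
  fixes ge :: "'a::comm_semiring_1 \<Rightarrow> 'a \<Rightarrow> bool"
  assumes preordered: "preordered_semiring ge" and one_ge_0: "ge 1 0"
begin

lemma ge_refl [simp, intro]: "ge a a"
  using preordered by (simp add: preordered_semiring_def)

lemma ge_trans [trans]: "ge a b \<Longrightarrow> ge b c \<Longrightarrow> ge a c"
  using preordered unfolding preordered_semiring_def by blast

lemma ge_add_right: "ge a b \<Longrightarrow> ge (a + c) (b + c)"
  using preordered unfolding preordered_semiring_def by blast

lemma ge_mult_right: "ge a b \<Longrightarrow> ge (a * c) (b * c)"
  using preordered unfolding preordered_semiring_def by blast

lemma ge_mult_left: "ge a b \<Longrightarrow> ge (c * a) (c * b)"
  using ge_mult_right[of a b c] by (simp add: mult.commute)

lemma ge_add_mono: "ge a b \<Longrightarrow> ge c d \<Longrightarrow> ge (a + c) (b + d)"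
  using ge_add_right[of a b c] ge_add_right[of c d b] ge_trans by (metis add.commute)

lemma ge_mult_mono: "ge a b \<Longrightarrow> ge c d \<Longrightarrow> ge (a * c) (b * d)"
  using ge_mult_right ge_mult_left ge_trans by blast

lemma ge_0 [simp, intro]: "ge a 0"
  using ge_mult_right[OF one_ge_0, of a] by simp

lemma ge_add_self [simp, intro]: "ge (a + b) a" "ge (b + a) a"
  using ge_add_mono[OF ge_refl[of a] ge_0[of b]] by (simp_all add: add.commute)

lemma ge_of_nat: "m \<le> n \<Longrightarrow> ge (of_nat n) (of_nat m)"
  by (metis le_add_diff_inverse of_nat_add ge_add_self(1))

lemma ge_peval: "ge (of_nat k) a \<Longrightarrow> ge (of_nat (poly p k)) (peval p a)"
  by (induction p) (auto intro: ge_add_mono ge_mult_mono)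

text \<open>A single copy of \<open>e\<close> serves as catalyst: each round turns one more
  \<open>s\<close> into \<open>t\<close> and gives \<open>e\<close> back, so \<open>e\<close> is not
  multiplied by \<open>n\<close>.\<close>

lemma ge_cancel_iterate:
  assumes "ge (e + s) (e + t)"
  shows "ge (e + of_nat n * s) (e + of_nat n * t)"
proof (induction n)
  case (Suc n)
  have "ge (e + of_nat n * s + s) (e + of_nat n * t + s)"
    by (rule ge_add_right[OF Suc])
  also have "e + of_nat n * t + s = e + s + of_nat n * t"
    by (simp add: ac_simps)
  also have "ge \<dots> (e + t + of_nat n * t)"
    by (rule ge_add_right[OF assms])
  finally show ?case
    by (simp add: algebra_simps)
qed simp

section \<open>Adjoining one inequality to a preorder\<close>

text \<open>Wherever \<open>a\<close> is above \<open>b\<close> and common summands cancel, s + b c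
  >= t + a c >= t + b c forces s >= t. Building this cancellation into the relation is what later
  lets totality follow from maximality.\<close>

definition adjoin :: "'a \<Rightarrow> 'a \<Rightarrow> 'a \<Rightarrow> 'a \<Rightarrow> bool" where
  "adjoin a b s t \<longleftrightarrow> (\<exists>c. ge (s + b * c) (t + a * c))"

lemma adjoin_extends: "ge s t \<Longrightarrow> adjoin a b s t"
  unfolding adjoin_def by (rule exI[of _ 0]) simp

lemma adjoin_self: "adjoin a b a b"
  unfolding adjoin_def by (rule exI[of _ 1]) (simp add: add.commute)

lemma adjoin_trans:
  assumes "adjoin a b s t" "adjoin a b t w"
  shows "adjoin a b s w"
proof -
  from assms obtain c d where c: "ge (s + b * c) (t + a * c)" and d: "ge (t + b * d) (w + a * d)"
    unfolding adjoin_def by blast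
  have "ge (s + b * c + b * d) (t + a * c + b * d)"
    by (rule ge_add_right[OF c])
  also have "t + a * c + b * d = t + b * d + a * c"
    by (simp add: algebra_simps)
  also have "ge \<dots> (w + a * d + a * c)"
    by (rule ge_add_right[OF d])
  finally have "ge (s + b * (c + d)) (w + a * (c + d))"
    by (simp add: algebra_simps)
  then show ?thesis
    unfolding adjoin_def by blast
qed

lemma nonneg_preorder_adjoin: "nonneg_preorder (adjoin a b)"
proof
  have "adjoin a b (s + w) (t + w) \<and> adjoin a b (s * w) (t * w)" if "adjoin a b s t" for s t w
  proof -
    from that obtain c where c: "ge (s + b * c) (t + a * c)"
      unfolding adjoin_def by blast
    have "ge (s + w + b * c) (t + w + a * c)"
      using ge_add_right[OF c, of w] by (simp add: ac_simps)
    moreover have "ge (s * w + b * (c * w)) (t * w + a * (c * w))"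
      using ge_mult_right[OF c, of w] by (simp add: algebra_simps)
    ultimately show ?thesis
      unfolding adjoin_def by blast
  qed
  then show "preordered_semiring (adjoin a b)"
    unfolding preordered_semiring_def by (auto intro: adjoin_extends adjoin_trans)
  show "adjoin a b 1 0"
    by (simp add: adjoin_extends one_ge_0)
qed

end

section \<open>Strassen's theorem for Archimedean preorders\<close>

locale archimedean_preorder = nonneg_preorder +
  assumes bounded_above: "\<exists>n. ge (of_nat n) a"
    and bounded_below: "a \<noteq> 0 \<Longrightarrow> \<exists>n. ge (of_nat n * a) 1"
begin

lemma archimedean_extension:
  assumes "nonneg_preorder ge'" "\<And>a b. ge a b \<Longrightarrow> ge' a b"
  shows "archimedean_preorder ge'"
proof (intro archimedean_preorder.intro archimedean_preorder_axioms.intro)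
  show "\<exists>n. ge' (of_nat n) a" for a
    using bounded_above[of a] assms(2) by blast
  show "\<exists>n. ge' (of_nat n * a) 1" if "a \<noteq> 0" for a
    using bounded_below[OF that] assms(2) by blast
qed (rule assms)

text \<open>Suppose both directions fail, with witnesses \<open>c\<close> and \<open>d\<close>.
  Multiplying the first inequality by \<open>d\<close>, the second by \<open>c\<close> and adding
  puts the terms a c d and b c d on both sides, which leaves E >= E + c + d. A multiple of
  \<open>c\<close> lies above 1, so a multiple of \<open>E\<close> breaks the assumption.\<close>

lemma adjoin_consistent:
  assumes "\<nexists>e. ge e (e + 1)"
  shows "(\<nexists>e. adjoin a b e (e + 1)) \<or> (\<nexists>e. adjoin b a e (e + 1))"
proof (rule ccontr)
  assume "\<not> ?thesis"
  then obtain e e' c d where c: "ge (e + b * c) (e + 1 + a * c)"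
    and d: "ge (e' + a * d) (e' + 1 + b * d)"
    unfolding adjoin_def by blast
  \<comment> \<open>For c = 0 the first inequality would read e >= e + 1.\<close>
  have "c \<noteq> 0"
    using c assms by auto
  then obtain k where k: "ge (of_nat k * c) 1"
    using bounded_below by blast
  define E where "E = e * d + e' * c + b * c * d + a * c * d"
  have "ge ((e + b * c) * d + (e' + a * d) * c) ((e + 1 + a * c) * d + (e' + 1 + b * d) * c)"
    by (intro ge_add_mono ge_mult_right c d)
  then have "ge E (E + c + d)"
    by (simp add: E_def algebra_simps)
  then have "ge (of_nat k * E) (of_nat k * (E + c + d))"
    by (rule ge_mult_left)
  also have "of_nat k * (E + c + d) = of_nat k * E + of_nat k * c + of_nat k * d"
    by (simp add: algebra_simps)
  also have "ge \<dots> (of_nat k * E + of_nat k * c)"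
    by (rule ge_add_self)
  also have "ge \<dots> (of_nat k * E + 1)"
    by (rule ge_add_mono[OF ge_refl k])
  finally show False
    using assms by blast
qed

text \<open>Zorn's lemma gives a maximal consistent preorder. For each pair, one of the two possible
  inequalities can be adjoined consistently, and by maximality it already holds.\<close>

lemma total_extension:
  assumes "\<nexists>e. ge e (e + 1)"
  obtains ge' where "nonneg_preorder ge'" "\<And>a b. ge a b \<Longrightarrow> ge' a b"
    "\<nexists>e. ge' e (e + 1)" "\<And>a b. ge' a b \<or> ge' b a"
proof -
  define \<A> where "\<A> = {R. nonneg_preorder (\<lambda>a b. (a, b) \<in> R) \<and>
      {(a, b). ge a b} \<subseteq> R \<and> (\<forall>e. (e, e + 1) \<notin> R)}"
  have "\<exists>M\<in>\<A>. \<forall>X\<in>\<A>. M \<subseteq> X \<longrightarrow> X = M"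
  proof (rule subset_Zorn_nonempty)
    have "{(a, b). ge a b} \<in> \<A>"
      using assms nonneg_preorder_axioms by (simp add: \<A>_def)
    then show "\<A> \<noteq> {}"
      by blast
  next
    fix \<C> assume ne: "\<C> \<noteq> {}" and chain: "subset.chain \<A> \<C>"
    then have pre: "nonneg_preorder (\<lambda>a b. (a, b) \<in> R)" if "R \<in> \<C>" for R
      using that by (auto simp: \<A>_def subset.chain_def)
    \<comment> \<open>Two pairs from the union lie in a common member of the chain, so each closure
      property can be checked inside one member.\<close>
    have directed: "\<exists>T\<in>\<C>. p \<in> T \<and> q \<in> T" if "p \<in> \<Union>\<C>" "q \<in> \<Union>\<C>" for p q
    proof -
      from that obtain S T where "S \<in> \<C>" "p \<in> S" "T \<in> \<C>" "q \<in> T"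
        by blast
      moreover from this have "S \<subseteq> T \<or> T \<subseteq> S"
        using chain unfolding subset.chain_def by blast
      ultimately show ?thesis
        by blast
    qed
    obtain R where R: "R \<in> \<C>"
      using ne by blast
    have "nonneg_preorder (\<lambda>a b. (a, b) \<in> \<Union>\<C>)"
    proof
      have "(a, a) \<in> \<Union>\<C>" for a
        using UnionI[OF R] nonneg_preorder.ge_refl[OF pre[OF R]] .
      moreover have "(a, c) \<in> \<Union>\<C>" if ab: "(a, b) \<in> \<Union>\<C>" and bc: "(b, c) \<in> \<Union>\<C>" for a b c
      proof -
        obtain T where T: "T \<in> \<C>" "(a, b) \<in> T" "(b, c) \<in> T"
          using directed[OF ab bc] by blast
        show ?thesis
          using UnionI[OF T(1)] nonneg_preorder.ge_trans[OF pre[OF T(1)] T(2,3)] .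
      qed
      moreover have "(a + c, b + c) \<in> \<Union>\<C> \<and> (a * c, b * c) \<in> \<Union>\<C>"
        if ab: "(a, b) \<in> \<Union>\<C>" for a b c
      proof -
        obtain T where T: "T \<in> \<C>" "(a, b) \<in> T"
          using ab by blast
        show ?thesis
          using UnionI[OF T(1) nonneg_preorder.ge_add_right[OF pre[OF T(1)] T(2)]]
            UnionI[OF T(1) nonneg_preorder.ge_mult_right[OF pre[OF T(1)] T(2)]] ..
      qed
      ultimately show "preordered_semiring (\<lambda>a b. (a, b) \<in> \<Union>\<C>)"
        unfolding preordered_semiring_def by (intro conjI allI impI) simp_all
      show "(1, 0) \<in> \<Union>\<C>"
        using UnionI[OF R] nonneg_preorder.ge_0[OF pre[OF R]] .
    qed
    moreover have "{(a, b). ge a b} \<subseteq> \<Union>\<C>" "\<forall>e. (e, e + 1) \<notin> \<Union>\<C>"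
      using ne chain unfolding subset.chain_def \<A>_def by blast+
    ultimately show "\<Union>\<C> \<in> \<A>"
      by (simp add: \<A>_def)
  qed
  then obtain M where M: "M \<in> \<A>" and maximal: "\<And>X. X \<in> \<A> \<Longrightarrow> M \<subseteq> X \<Longrightarrow> X = M"
    by blast
  define ge' where "ge' = (\<lambda>a b. (a, b) \<in> M)"
  have pre: "nonneg_preorder ge'" and ext: "\<And>a b. ge a b \<Longrightarrow> ge' a b"
    and cons: "\<nexists>e. ge' e (e + 1)"
    using M by (auto simp: \<A>_def ge'_def)
  interpret M: archimedean_preorder ge'
    using pre ext by (rule archimedean_extension)
  \<comment> \<open>A consistent adjunction is again a member of \<open>\<A>\<close> containing
    \<open>M\<close>, hence equals \<open>M\<close>.\<close>
  have adjoin_in: "ge' a b" if "\<nexists>e. M.adjoin a b e (e + 1)" for a b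
  proof -
    have "{(s, t). M.adjoin a b s t} \<in> \<A>"
      using that M.nonneg_preorder_adjoin ext M.adjoin_extends by (auto simp: \<A>_def)
    then have "{(s, t). M.adjoin a b s t} = M"
      using M.adjoin_extends by (intro maximal) (auto simp: ge'_def)
    then show ?thesis
      using M.adjoin_self by (auto simp: ge'_def)
  qed
  show ?thesis
    using M.adjoin_consistent[OF cons] adjoin_in by (intro that[OF pre ext cons]) blast+
qed

end

section \<open>The real-valued homomorphism of a total Archimedean preorder\<close>

text \<open>The identities for \<open>val\<close> are first obtained after scaling by
  \<open>n\<close>, with an error independent of \<open>n\<close>; this removes the error.\<close>

lemma eq_if_close:
  fixes s t K :: real
  assumes "\<And>n::nat. real n * \<bar>s - t\<bar> \<le> K"
  shows "s = t"
proof (rule ccontr)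
  assume "s \<noteq> t"
  then obtain n where "K < real n * \<bar>s - t\<bar>"
    using ex_less_of_nat_mult[of "\<bar>s - t\<bar>" K] by auto
  then show False
    using assms[of n] by simp
qed

locale total_archimedean_preorder = archimedean_preorder +
  assumes consistent: "\<not> ge e (e + 1)" and total: "ge a b \<or> ge b a"
begin

text \<open>If m >= n held with m < n, then m >= n >= m + 1, which consistency excludes.\<close>

lemma ge_of_nat_iff: "ge (of_nat m) (of_nat n) \<longleftrightarrow> n \<le> m"
proof
  show "n \<le> m" if "ge (of_nat m) (of_nat n)"
  proof (rule ccontr)
    assume "\<not> n \<le> m"
    then have "ge (of_nat n) (of_nat m + 1)"
      using ge_of_nat[of "Suc m" n] by (simp add: add.commute)
    then show False
      using that consistent ge_trans by blast
  qed
qed (rule ge_of_nat)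

definition upper_fractions :: "'a \<Rightarrow> real set" where
  "upper_fractions a = {real m / real n | m n. 0 < n \<and> ge (of_nat m) (of_nat n * a)}"

text \<open>The real number of the Dedekind cut that \<open>a\<close> makes among the nonnegative
  fractions.\<close>

definition val :: "'a \<Rightarrow> real" where
  "val a = Inf (upper_fractions a)"

lemma upper_fractions_nonempty: "upper_fractions a \<noteq> {}"
proof -
  obtain n where "ge (of_nat n) a"
    using bounded_above by blast
  then have "real n / real 1 \<in> upper_fractions a"
    unfolding upper_fractions_def by (intro CollectI exI[of _ n] exI[of _ 1]) simp
  then show ?thesis
    by blast
qed

lemma upper_fractions_nonneg: "t \<in> upper_fractions a \<Longrightarrow> 0 \<le> t"
  by (auto simp: upper_fractions_def)

lemma val_nonneg: "0 \<le> val a"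
  unfolding val_def by (intro cInf_greatest upper_fractions_nonempty upper_fractions_nonneg)

lemma val_le:
  assumes "ge (of_nat m) (of_nat n * a)"
  shows "real n * val a \<le> real m"
proof (cases "n = 0")
  case False
  then have "real m / real n \<in> upper_fractions a"
    using assms by (auto simp: upper_fractions_def)
  then have "val a \<le> real m / real n"
    unfolding val_def by (intro cInf_lower) (auto intro: bdd_belowI upper_fractions_nonneg)
  then show ?thesis
    using False by (simp add: field_simps)
qed simp

text \<open>Every upper fraction m'/n' satisfies n m' >= n' n a >= n' m in the preorder, and on
  natural numbers the preorder is the usual order.\<close>

lemma le_val:
  assumes "ge (of_nat n * a) (of_nat m)"
  shows "real m \<le> real n * val a"
proof (cases "n = 0")
  case True
  then show ?thesis
    using assms ge_of_nat_iff[of 0 m] by simp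
next
  case False
  have "real m / real n \<le> val a"
    unfolding val_def
  proof (rule cInf_greatest[OF upper_fractions_nonempty])
    fix t assume "t \<in> upper_fractions a"
    then obtain m' n' where t: "t = real m' / real n'" "0 < n'" "ge (of_nat m') (of_nat n' * a)"
      by (auto simp: upper_fractions_def)
    have "ge (of_nat n * of_nat m') (of_nat n * (of_nat n' * a))"
      by (rule ge_mult_left[OF t(3)])
    also have "of_nat n * (of_nat n' * a) = of_nat n' * (of_nat n * a)"
      by (simp add: algebra_simps)
    also have "ge \<dots> (of_nat n' * of_nat m)"
      by (rule ge_mult_left[OF assms])
    finally have "ge (of_nat (n * m')) (of_nat (n' * m))"
      by simp
    then have "n' * m \<le> n * m'"
      by (simp only: ge_of_nat_iff)
    then have "real n' * real m \<le> real n * real m'"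
      by (metis of_nat_le_iff of_nat_mult)
    then show "real m / real n \<le> t"
      unfolding t(1) using t(2) False by (simp add: field_simps)
  qed
  then show ?thesis
    using False by (simp add: field_simps)
qed

text \<open>The least natural number above \<open>n * a\<close> overshoots by at most 1: by totality
  its predecessor lies below \<open>n * a\<close>.\<close>

lemma approx:
  obtains m where "ge (of_nat m) (of_nat n * a)" "ge (of_nat n * a + 1) (of_nat m)"
    "real n * val a \<le> real m" "real m \<le> real n * val a + 1"
proof -
  define m where "m = (LEAST m. ge (of_nat m) (of_nat n * a))"
  have upper: "ge (of_nat m) (of_nat n * a)"
    unfolding m_def using bounded_above by (rule LeastI_ex)
  have lower: "ge (of_nat n * a + 1) (of_nat m) \<and> real m \<le> real n * val a + 1"
  proof (cases m)
    case 0
    then show ?thesis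
      using val_nonneg by simp
  next
    case (Suc k)
    then have "\<not> ge (of_nat k) (of_nat n * a)"
      unfolding m_def by (intro not_less_Least) simp
    then have k: "ge (of_nat n * a) (of_nat k)"
      using total by blast
    then have "ge (of_nat n * a + 1) (of_nat k + 1)"
      by (rule ge_add_right)
    then show ?thesis
      using le_val[OF k] Suc by (simp add: add.commute)
  qed
  show ?thesis
    using that upper lower val_le[OF upper] by blast
qed

lemma val_of_nat: "val (of_nat n) = real n"
  using val_le[of n 1 "of_nat n"] le_val[of 1 "of_nat n" n] by simp

lemma val_mono:
  assumes "ge a b"
  shows "val b \<le> val a"
proof (rule ccontr)
  assume "\<not> val b \<le> val a"
  \<comment> \<open>The gap is scaled beyond 1, the error of the approximation.\<close>
  then obtain n where n: "1 < real n * (val b - val a)"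
    using ex_less_of_nat_mult[of "val b - val a" 1] by auto
  obtain m where "ge (of_nat m) (of_nat n * a)" and m: "real m \<le> real n * val a + 1"
    by (rule approx)
  then have "ge (of_nat m) (of_nat n * b)"
    using ge_mult_left[OF assms] ge_trans by blast
  then show False
    using val_le m n by (fastforce simp: algebra_simps)
qed

lemma val_add: "val (a + b) = val a + val b"
proof (rule eq_if_close)
  fix n
  obtain k where k: "ge (of_nat k) (of_nat n * a)" "ge (of_nat n * a + 1) (of_nat k)"
    "real n * val a \<le> real k" "real k \<le> real n * val a + 1"
    by (rule approx)
  obtain l where l: "ge (of_nat l) (of_nat n * b)" "ge (of_nat n * b + 1) (of_nat l)"
    "real n * val b \<le> real l" "real l \<le> real n * val b + 1"
    by (rule approx)
  obtain m where m: "ge (of_nat m) (of_nat n * (a + b))" "ge (of_nat n * (a + b) + 1) (of_nat m)"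
    "real n * val (a + b) \<le> real m" "real m \<le> real n * val (a + b) + 1"
    by (rule approx)
  have "ge (of_nat (k + l)) (of_nat n * (a + b))"
    using ge_add_mono[OF k(1) l(1)] by (simp add: algebra_simps)
  then have "real n * val (a + b) \<le> real (k + l)"
    by (rule val_le)
  moreover have "real (k + l) \<le> real (m + 2)"
  proof -
    have "ge (of_nat m + (1 + 1)) (of_nat n * (a + b) + (1 + 1))"
      by (rule ge_add_right[OF m(1)])
    also have "of_nat n * (a + b) + (1 + 1) = (of_nat n * a + 1) + (of_nat n * b + 1)"
      by (simp only: algebra_simps)
    also have "ge \<dots> (of_nat k + of_nat l)"
      by (rule ge_add_mono[OF k(2) l(2)])
    finally have "ge (of_nat (Suc (Suc m))) (of_nat (k + l))"
      by (simp only: of_nat_Suc of_nat_add ac_simps)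
    then have "k + l \<le> Suc (Suc m)"
      by (simp only: ge_of_nat_iff)
    then show ?thesis
      by linarith
  qed
  \<comment> \<open>The approximation errors add up to at most 3; any bound independent of
    \<open>n\<close> would do.\<close>
  ultimately have "\<bar>real n * (val (a + b) - (val a + val b))\<bar> \<le> 5"
    using k l m by (simp add: algebra_simps abs_le_iff)
  then show "real n * \<bar>val (a + b) - (val a + val b)\<bar> \<le> 5"
    by (simp add: abs_mult)
qed

lemma val_of_nat_mult: "val (of_nat n * a) = real n * val a"
proof (induction n)
  case 0
  show ?case using val_of_nat[of 0] by simp
next
  case (Suc n)
  then show ?case by (simp add: distrib_right val_add)
qed

text \<open>Approximants \<open>k\<close> of n a and \<open>l\<close> of n b give n^2 a b <= k l <=
  (n a + 1)(n b + 1). The error is linear in \<open>n\<close> while the main term is quadratic, so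
  dividing by \<open>n\<close> leaves a bounded error.\<close>

lemma val_mult: "val (a * b) = val a * val b"
proof (rule eq_if_close)
  fix n
  \<comment> \<open>For n >= 1 this dominates the error n val(a) + n val(b) + 1 divided by
    \<open>n\<close>.\<close>
  define K where "K = val a + val b + 1"
  show "real n * \<bar>val (a * b) - val a * val b\<bar> \<le> K"
  proof (cases "n = 0")
    case True
    then show ?thesis
      using val_nonneg[of a] val_nonneg[of b] by (simp add: K_def)
  next
    case False
    obtain k where k: "ge (of_nat k) (of_nat n * a)" "ge (of_nat n * a + 1) (of_nat k)"
      "real n * val a \<le> real k" "real k \<le> real n * val a + 1"
      by (rule approx)
    obtain l where l: "ge (of_nat l) (of_nat n * b)" "ge (of_nat n * b + 1) (of_nat l)"
      "real n * val b \<le> real l" "real l \<le> real n * val b + 1"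
      by (rule approx)
    have "val (of_nat (n * n) * (a * b)) \<le> val (of_nat (k * l))"
      using ge_mult_mono[OF k(1) l(1)] by (intro val_mono) (simp add: ac_simps)
    then have 1: "real n * real n * val (a * b) \<le> real k * real l"
      unfolding val_of_nat_mult val_of_nat of_nat_mult[where 'a = real] .
    have "val (of_nat (k * l)) \<le>
        val (of_nat (n * n) * (a * b) + of_nat n * a + of_nat n * b + of_nat 1)"
      using ge_mult_mono[OF k(2) l(2)] by (intro val_mono) (simp add: algebra_simps)
    then have 2: "real k * real l \<le>
        real n * real n * val (a * b) + real n * val a + real n * val b + 1"
      unfolding val_add val_of_nat_mult val_of_nat of_nat_mult[where 'a = real] of_nat_1[where 'a = real] .
    have 3: "real k * real l \<le> (real n * val a + 1) * (real n * val b + 1)"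
      using k(4) l(4) val_nonneg[of a] by (intro mult_mono) auto
    have 4: "(real n * val a) * (real n * val b) \<le> real k * real l"
      using k(3) l(3) val_nonneg[of b] by (intro mult_mono) auto
    have "\<bar>real n * real n * (val (a * b) - val a * val b)\<bar> \<le> real n * val a + real n * val b + 1"
      using 1 2 3 4 by (simp add: algebra_simps abs_le_iff)
    also have "\<dots> \<le> real n * K"
      using False by (simp add: K_def algebra_simps)
    finally have "real n * (real n * \<bar>val (a * b) - val a * val b\<bar>) \<le> real n * K"
      by (simp add: abs_mult)
    then show ?thesis
      using False by simp
  qed
qed

lemma monotone_hom_val: "monotone_hom_Rplus ge val"
  using val_of_nat[of 0] val_of_nat[of 1]
  by (simp add: monotone_hom_Rplus_def val_nonneg val_add val_mult val_mono)

end

section \<open>Separating homomorphisms\<close>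

context archimedean_preorder
begin

text \<open>The inequality k y >= k x + 1 is adjoined. Were this inconsistent, iterating the
  contradiction would produce a catalyst \<open>z\<close> of the excluded kind. The value map of a
  total extension then satisfies k f(x) + 1 <= k f(y).\<close>

lemma exists_separating_hom:
  assumes "0 < k"
    and no_catalyst: "\<And>z. z \<noteq> 0 \<Longrightarrow> \<not> ge (of_nat k * z * x + (z + z)) (of_nat k * z * y)"
  obtains f where "monotone_hom_Rplus ge f" "f x < f y"
proof -
  \<comment> \<open>The summand 1 in \<open>X\<close> accounts for one of the two copies of
    \<open>z\<close> in \<open>no_catalyst\<close>; the other copy absorbs the constant left over
    from the iteration.\<close>
  define X where "X = of_nat k * x + 1"
  define Y where "Y = of_nat k * y"
  have nontrivial: "\<not> ge 0 1"
  proof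
    assume "ge 0 1"
    then have "ge 0 (of_nat k * 1 * y)"
      using ge_mult_right[of 0 1 "of_nat k * 1 * y"] by simp
    with ge_0 have "ge (of_nat k * 1 * x + (1 + 1)) (of_nat k * 1 * y)"
      by (rule ge_trans)
    then show False
      using no_catalyst[OF one_neq_zero] by blast
  qed
  have cons: "\<nexists>e. adjoin Y X e (e + 1)"
  proof
    assume "\<exists>e. adjoin Y X e (e + 1)"
    then obtain e c where c: "ge (e + X * c) (e + (1 + Y * c))"
      unfolding adjoin_def by (auto simp: add.assoc)
    obtain n0 where n0: "ge (of_nat n0) e"
      using bounded_above by blast
    \<comment> \<open>The successor ensures that \<open>n\<close> is above 1, hence nonzero in the
      semiring and usable as a catalyst.\<close>
    define n where "n = Suc n0"
    have n: "ge (of_nat n) e"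
      using ge_trans[OF ge_of_nat[of n0 n] n0] by (simp add: n_def)
    have n1: "ge (of_nat n) 1"
      using ge_of_nat[of 1 n] by (simp add: n_def)
    then have n_nonzero: "(of_nat n :: 'a) \<noteq> 0"
      using nontrivial by auto
    have iter: "ge (of_nat n + of_nat N * (X * c)) (of_nat N * (1 + Y * c))" for N
    proof -
      have "ge (of_nat n + of_nat N * (X * c)) (e + of_nat N * (X * c))"
        by (rule ge_add_right[OF n])
      also have "ge \<dots> (e + of_nat N * (1 + Y * c))"
        by (rule ge_cancel_iterate[OF c])
      also have "ge \<dots> (of_nat N * (1 + Y * c))"
        by (rule ge_add_self)
      finally show ?thesis .
    qed
    show False
    proof (cases "c = 0")
      case True
      \<comment> \<open>With c = 0 the iteration makes \<open>n\<close> dominate every natural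
        number, in particular \<open>k * n * l\<close>, which lies above k n y. So \<open>n\<close>
        itself is an excluded catalyst.\<close>
      obtain l where l: "ge (of_nat l) y"
        using bounded_above by blast
      have "ge (of_nat k * of_nat n * x + (of_nat n + of_nat n)) (of_nat n)"
        using ge_add_self(2)[of "of_nat k * of_nat n * x + of_nat n" "of_nat n"]
        by (simp only: add.assoc)
      also have "ge (of_nat n) (of_nat (k * n * l))"
        using iter[of "k * n * l"] True by simp
      also have "ge (of_nat (k * n * l)) (of_nat k * of_nat n * y)"
        using ge_mult_left[OF l, of "of_nat k * of_nat n"] by simp
      finally show False
        using no_catalyst[OF n_nonzero] by blast
    next
      case False
      then obtain j where j: "ge (of_nat j * c) 1"
        using bounded_below by blast
      \<comment> \<open>Chosen so that N c >= n: then N c can replace the constant \<open>n\<close>,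
        and \<open>N * c\<close> becomes the excluded catalyst.\<close>
      define N where "N = n * j"
      have Nc: "ge (of_nat N * c) (of_nat n)"
        using ge_mult_left[OF j, of "of_nat n"] by (simp add: N_def ac_simps)
      then have "ge (of_nat N * c + of_nat N * (X * c)) (of_nat n + of_nat N * (X * c))"
        by (rule ge_add_right)
      also have "ge \<dots> (of_nat N * (1 + Y * c))"
        by (rule iter)
      also have "ge \<dots> (of_nat N * (Y * c))"
        by (intro ge_mult_left ge_add_self)
      finally have "ge (of_nat k * (of_nat N * c) * x + (of_nat N * c + of_nat N * c)) (of_nat k * (of_nat N * c) * y)"
        by (simp add: X_def Y_def algebra_simps)
      moreover have "of_nat N * c \<noteq> 0"
        using ge_trans[OF Nc n1] nontrivial by auto
      ultimately show False
        using no_catalyst by blast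
    qed
  qed
  then interpret A: archimedean_preorder "adjoin Y X"
    by (intro archimedean_extension nonneg_preorder_adjoin adjoin_extends)
  obtain ge' where pre: "nonneg_preorder ge'" and ext: "\<And>a b. adjoin Y X a b \<Longrightarrow> ge' a b"
    and ge': "\<nexists>e. ge' e (e + 1)" "\<And>a b. ge' a b \<or> ge' b a"
    using A.total_extension cons by blast
  interpret T: total_archimedean_preorder ge'
    using A.archimedean_extension[OF pre ext] ge'
    by (simp add: total_archimedean_preorder_def total_archimedean_preorder_axioms_def)
  have "T.val X \<le> T.val Y"
    by (intro T.val_mono ext adjoin_self)
  then have "real k * T.val x + 1 \<le> real k * T.val y"
    using T.val_of_nat[of 1] by (simp add: X_def Y_def T.val_add T.val_of_nat_mult)
  then have "real k * T.val x < real k * T.val y"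
    by simp
  then have "T.val x < T.val y"
    by (simp add: mult_less_cancel_left)
  moreover have "monotone_hom_Rplus ge T.val"
    using T.monotone_hom_val T.val_mono[OF ext[OF adjoin_extends]]
    unfolding monotone_hom_Rplus_def by simp
  ultimately show ?thesis
    by (intro that)
qed

end

section \<open>Polynomially universal elements\<close>

text \<open>Excluding 0 >= 1 leaves out the degenerate case in which every element is above every
  other; the theorem treats it separately.\<close>

locale poly_universal_preorder = nonneg_preorder +
  fixes u
  assumes universal: "poly_universal ge u" and nontrivial: "\<not> ge 0 1"
begin

lemma poly_above: "\<exists>p. ge (peval p u) a"
  by (cases "a = 0") (use universal ge_0 in \<open>auto simp: poly_universal_def\<close>)

lemma poly_below: "a \<noteq> 0 \<Longrightarrow> \<exists>p. ge (peval p u * a) 1"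
  using universal unfolding poly_universal_def by blast

lemma nonzero_if_ge_1: "ge a 1 \<Longrightarrow> a \<noteq> 0"
  using nontrivial by blast

text \<open>Polynomial multiples of \<open>a\<close> and of \<open>b\<close> lie above 1, hence so
  does their product; if a b = 0, this would say 0 >= 1. It keeps products of catalysts
  nonzero.\<close>

lemma mult_nonzero:
  fixes a b :: 'a
  assumes "a \<noteq> 0" "b \<noteq> 0"
  shows "a * b \<noteq> 0"
proof
  assume ab: "a * b = 0"
  obtain p q where "ge (peval p u * a) 1" "ge (peval q u * b) 1"
    using assms poly_below by blast
  then have "ge (peval p u * a * (peval q u * b)) (1 * 1)"
    by (rule ge_mult_mono)
  also have "peval p u * a * (peval q u * b) = peval p u * peval q u * (a * b)"
    by (simp add: ac_simps)
  finally show False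
    using ab nontrivial by simp
qed

section \<open>The asymptotic preorder at a real number\<close>

text \<open>After formal division by \<open>m * z\<close> this reads a + p(u)/m >= b, with an error
  that is small once \<open>u\<close> is evaluated at \<open>r\<close>. The factor \<open>z\<close>
  is a catalyst.\<close>

definition asymp_ge :: "real \<Rightarrow> 'a \<Rightarrow> 'a \<Rightarrow> bool" where
  "asymp_ge r a b \<longleftrightarrow> (\<forall>\<epsilon>>0. \<exists>p z m. z \<noteq> 0 \<and> 0 < m \<and> peval p r \<le> \<epsilon> * real m \<and>
     ge (of_nat m * z * a + peval p u * z) (of_nat m * z * b))"

lemma asymp_geE:
  assumes "asymp_ge r a b" "0 < \<epsilon>"
  obtains p z m where "z \<noteq> 0" "0 < m" "peval p r \<le> \<epsilon> * real m"
    "ge (of_nat m * z * a + peval p u * z) (of_nat m * z * b)"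
  using assms unfolding asymp_ge_def by blast

lemma asymp_ge_extends: "ge a b \<Longrightarrow> asymp_ge r a b"
  unfolding asymp_ge_def
  by (intro allI impI exI[of _ 0] exI[of _ 1] exI[of _ "1::nat"]) simp

text \<open>Each inequality is multiplied by the catalyst and multiplicity of the other, and each
  contributes half of the error.\<close>

lemma asymp_ge_trans:
  assumes "asymp_ge r a b" "asymp_ge r b c"
  shows "asymp_ge r a c"
  unfolding asymp_ge_def
proof (intro allI impI)
  fix \<epsilon> :: real
  assume "0 < \<epsilon>"
  then have \<epsilon>: "0 < \<epsilon> / 2"
    by simp
  obtain p z m where 1: "z \<noteq> 0" "0 < m" "peval p r \<le> \<epsilon> / 2 * real m"
    "ge (of_nat m * z * a + peval p u * z) (of_nat m * z * b)"
    by (rule asymp_geE[OF assms(1) \<epsilon>])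
  obtain q w n where 2: "w \<noteq> 0" "0 < n" "peval q r \<le> \<epsilon> / 2 * real n"
    "ge (of_nat n * w * b + peval q u * w) (of_nat n * w * c)"
    by (rule asymp_geE[OF assms(2) \<epsilon>])
  have "ge (of_nat n * w * (of_nat m * z * a + peval p u * z) + of_nat m * z * (peval q u * w))
      (of_nat n * w * (of_nat m * z * b) + of_nat m * z * (peval q u * w))"
    by (intro ge_add_right ge_mult_left 1)
  also have "\<dots> = of_nat m * z * (of_nat n * w * b + peval q u * w)"
    by (simp add: algebra_simps)
  also have "ge \<dots> (of_nat m * z * (of_nat n * w * c))"
    by (intro ge_mult_left 2)
  finally have "ge (of_nat (m * n) * (z * w) * a + peval (smult n p + smult m q) u * (z * w))
      (of_nat (m * n) * (z * w) * c)"
    by (simp add: algebra_simps)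
  moreover have "peval (smult n p + smult m q) r \<le> \<epsilon> * real (m * n)"
    using mult_left_mono[OF 1(3), of "real n"] mult_left_mono[OF 2(3), of "real m"]
    by (simp add: algebra_simps)
  moreover have "z * w \<noteq> 0" "0 < m * n"
    using mult_nonzero 1 2 by auto
  ultimately show "\<exists>p z m. z \<noteq> 0 \<and> 0 < m \<and> peval p r \<le> \<epsilon> * real m \<and>
      ge (of_nat m * z * a + peval p u * z) (of_nat m * z * c)"
    by blast
qed

lemma asymp_ge_add_right:
  assumes "asymp_ge r a b"
  shows "asymp_ge r (a + c) (b + c)"
  unfolding asymp_ge_def
proof (intro allI impI)
  fix \<epsilon> :: real
  assume "0 < \<epsilon>"
  then obtain p z m where 1: "z \<noteq> 0" "0 < m" "peval p r \<le> \<epsilon> * real m"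
    "ge (of_nat m * z * a + peval p u * z) (of_nat m * z * b)"
    by (rule asymp_geE[OF assms])
  have "ge (of_nat m * z * (a + c) + peval p u * z) (of_nat m * z * (b + c))"
    using ge_add_right[OF 1(4), of "of_nat m * z * c"] by (simp add: algebra_simps)
  with 1 show "\<exists>p z m. z \<noteq> 0 \<and> 0 < m \<and> peval p r \<le> \<epsilon> * real m \<and>
      ge (of_nat m * z * (a + c) + peval p u * z) (of_nat m * z * (b + c))"
    by blast
qed

lemma asymp_ge_mult_right:
  assumes "0 \<le> r" "asymp_ge r a b"
  shows "asymp_ge r (a * c) (b * c)"
  unfolding asymp_ge_def
proof (intro allI impI)
  fix \<epsilon> :: real
  assume \<epsilon>: "0 < \<epsilon>"
  obtain q where q: "ge (peval q u) c"
    using poly_above by blast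
  have q0: "0 \<le> peval q r"
    by (rule peval_nonneg[OF assms(1)])
  \<comment> \<open>Multiplication by \<open>c\<close> inflates the error by at most the factor
    q(u), so \<open>\<epsilon>\<close> is divided by q(r) in advance; adding 1 avoids division by
    zero.\<close>
  with \<epsilon> have "0 < \<epsilon> / (peval q r + 1)"
    by simp
  then obtain p z m where 1: "z \<noteq> 0" "0 < m" "peval p r \<le> \<epsilon> / (peval q r + 1) * real m"
    "ge (of_nat m * z * a + peval p u * z) (of_nat m * z * b)"
    by (rule asymp_geE[OF assms(2)])
  have "ge (of_nat m * z * (a * c) + peval (p * q) u * z) (of_nat m * z * (a * c) + peval p u * c * z)"
    by (simp, intro ge_add_mono ge_mult_mono ge_refl q)
  also have "\<dots> = (of_nat m * z * a + peval p u * z) * c"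
    by (simp add: algebra_simps)
  also have "ge \<dots> (of_nat m * z * b * c)"
    by (rule ge_mult_right[OF 1(4)])
  also have "\<dots> = of_nat m * z * (b * c)"
    by (simp add: ac_simps)
  finally have "ge (of_nat m * z * (a * c) + peval (p * q) u * z) (of_nat m * z * (b * c))" .
  moreover have "peval (p * q) r \<le> \<epsilon> * real m"
  proof -
    have "peval p r * peval q r \<le> peval p r * (peval q r + 1)"
      using peval_nonneg[OF assms(1), of p] by (simp add: algebra_simps)
    also have "\<dots> \<le> \<epsilon> / (peval q r + 1) * real m * (peval q r + 1)"
      using 1(3) q0 by (intro mult_right_mono) auto
    also have "\<dots> = \<epsilon> * real m"
      using q0 by simp
    finally show ?thesis
      by simp
  qed
  ultimately show "\<exists>p z m. z \<noteq> 0 \<and> 0 < m \<and> peval p r \<le> \<epsilon> * real m \<and>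
      ge (of_nat m * z * (a * c) + peval p u * z) (of_nat m * z * (b * c))"
    using 1 by blast
qed

lemma nonneg_preorder_asymp_ge:
  assumes "0 \<le> r"
  shows "nonneg_preorder (asymp_ge r)"
proof
  show "preordered_semiring (asymp_ge r)"
    unfolding preordered_semiring_def
    by (intro conjI allI impI asymp_ge_extends[OF ge_refl] asymp_ge_add_right
        asymp_ge_mult_right[OF assms]) (rule asymp_ge_trans)
  show "asymp_ge r 1 0"
    by (simp add: asymp_ge_extends)
qed

text \<open>With m = k^N and error polynomial X^(N+1), the relative error r^(N+1)/k^N tends to 0
  because r < k.\<close>

lemma asymp_ge_of_nat:
  assumes "0 \<le> r" "r < real k"
  shows "asymp_ge r (of_nat k) u"
  unfolding asymp_ge_def
proof (intro allI impI)
  fix \<epsilon> :: real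
  assume \<epsilon>: "0 < \<epsilon>"
  \<comment> \<open>The witnesses start at 1 and satisfy z' = k z + u^(N+1), a homogeneous geometric
    sum.\<close>
  have geometric: "\<exists>z. ge z (of_nat k ^ N) \<and> ge (of_nat k * z + u ^ Suc N) (u * z)" for N
  proof (induction N)
    case 0
    show ?case
      by (rule exI[of _ 1]) simp
  next
    case (Suc N)
    then obtain z where z: "ge z (of_nat k ^ N)" "ge (of_nat k * z + u ^ Suc N) (u * z)"
      by blast
    have "ge (of_nat k * z + u ^ Suc N) (of_nat k * of_nat k ^ N)"
      using ge_mult_left[OF z(1)] ge_add_self ge_trans by blast
    moreover have "ge (of_nat k * (of_nat k * z + u ^ Suc N) + u ^ Suc (Suc N))
        (of_nat k * (u * z) + u ^ Suc (Suc N))"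
      by (intro ge_add_right ge_mult_left z)
    then have "ge (of_nat k * (of_nat k * z + u ^ Suc N) + u ^ Suc (Suc N))
        (u * (of_nat k * z + u ^ Suc N))"
      by (simp add: algebra_simps)
    ultimately show ?case
      by auto
  qed
  have k: "0 < k"
    using assms by (cases k) auto
  then have "0 < k ^ N" for N
    by simp
  have "\<exists>N. (r / real k) ^ N < \<epsilon> / (r + 1)"
    using assms \<epsilon> k by (intro real_arch_pow_inv) (auto simp: field_simps)
  then obtain N where N: "(r / real k) ^ N < \<epsilon> / (r + 1)"
    by blast
  have small: "r ^ Suc N \<le> \<epsilon> * real (k ^ N)"
  proof -
    have "r ^ N * (r + 1) \<le> \<epsilon> * real k ^ N"
      using N assms k by (simp add: field_simps power_divide)
    moreover have "r ^ N * r \<le> r ^ N * (r + 1)"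
      using assms by (intro mult_left_mono) auto
    ultimately show ?thesis
      by (simp add: ac_simps)
  qed
  obtain z where z: "ge z (of_nat k ^ N)" "ge (of_nat k * z + u ^ Suc N) (u * z)"
    using geometric by blast
  have "z \<noteq> 0"
    using z(1) ge_of_nat[of 1 "k ^ N"] k
    by (intro nonzero_if_ge_1) (auto intro: ge_trans)
  \<comment> \<open>The bound z >= k^N turns the error u^(N+1) z into k^N times the error in
    \<open>geometric\<close>.\<close>
  have "ge (of_nat (k ^ N) * z * of_nat k + u ^ Suc N * z)
      (of_nat (k ^ N) * z * of_nat k + u ^ Suc N * of_nat k ^ N)"
    by (intro ge_add_mono ge_mult_left z ge_refl)
  also have "\<dots> = of_nat (k ^ N) * (of_nat k * z + u ^ Suc N)"
    by (simp add: algebra_simps)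
  also have "ge \<dots> (of_nat (k ^ N) * (u * z))"
    by (intro ge_mult_left z)
  finally have "ge (of_nat (k ^ N) * z * of_nat k + peval ([:0, 1:] ^ Suc N) u * z)
      (of_nat (k ^ N) * z * u)"
    by (simp add: ac_simps)
  moreover have "peval ([:0, 1:] ^ Suc N) r \<le> \<epsilon> * real (k ^ N)"
    using small by simp
  ultimately show "\<exists>p z m. z \<noteq> 0 \<and> 0 < m \<and> peval p r \<le> \<epsilon> * real m \<and>
      ge (of_nat m * z * of_nat k + peval p u * z) (of_nat m * z * u)"
    using \<open>z \<noteq> 0\<close> \<open>0 < k ^ N\<close> by blast
qed

text \<open>For a natural number k > r the element \<open>u\<close> lies below \<open>k\<close>, so
  p(u) may be replaced by the natural number p(k) in both polynomial bounds.\<close>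

lemma archimedean_preorder_asymp_ge:
  assumes "0 \<le> r"
  shows "archimedean_preorder (asymp_ge r)"
proof -
  interpret A: nonneg_preorder "asymp_ge r"
    by (rule nonneg_preorder_asymp_ge[OF assms])
  obtain k where "r < real k"
    using reals_Archimedean2 by blast
  then have k: "asymp_ge r (of_nat k) u"
    by (rule asymp_ge_of_nat[OF assms])
  show ?thesis
  proof
    fix a
    obtain p where "ge (peval p u) a"
      using poly_above by blast
    then show "\<exists>n. asymp_ge r (of_nat n) a"
      using A.ge_peval[OF k] asymp_ge_extends A.ge_trans by blast
  next
    fix a :: 'a
    assume "a \<noteq> 0"
    then obtain p where "ge (peval p u * a) 1"
      using poly_below by blast
    then show "\<exists>n. asymp_ge r (of_nat n * a) 1"
      using A.ge_mult_right[OF A.ge_peval[OF k]] asymp_ge_extends A.ge_trans by blast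
  qed
qed

text \<open>
  The asymptotic preorder is closed under cancellation and under limits \<open>k \<rightarrow> \<infinity>\<close>: since the polynomial
  compensating for \<open>z\<close> is known before the inner \<open>\<delta>\<close> is chosen, its value at \<open>r\<close> does no harm.
\<close>

lemma asymp_ge_closed:
  assumes "0 \<le> r" "\<not> asymp_ge r x y"
  obtains k where "0 < k"
    "\<And>z. z \<noteq> 0 \<Longrightarrow> \<not> asymp_ge r (of_nat k * z * x + (z + z)) (of_nat k * z * y)"
proof -
  obtain \<epsilon> where \<epsilon>: "0 < \<epsilon>" and no: "\<And>p z m. z \<noteq> 0 \<Longrightarrow> 0 < m \<Longrightarrow> peval p r \<le> \<epsilon> * real m \<Longrightarrow>
      \<not> ge (of_nat m * z * x + peval p u * z) (of_nat m * z * y)"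
    using assms unfolding asymp_ge_def by blast
  \<comment> \<open>Of the 3, two units pay for \<open>z + z\<close> and one for the inner error
    after multiplication by q(u).\<close>
  obtain k where k: "3 / \<epsilon> < real k"
    using reals_Archimedean2 by blast
  have k3: "3 \<le> \<epsilon> * real k"
    using k \<epsilon> by (simp add: field_simps)
  have "0 < k"
    using k3 by (cases k) auto
  moreover have "\<not> asymp_ge r (of_nat k * z * x + (z + z)) (of_nat k * z * y)" if "z \<noteq> 0" for z
  proof
    assume close: "asymp_ge r (of_nat k * z * x + (z + z)) (of_nat k * z * y)"
    obtain q where q: "ge (peval q u * z) 1"
      using poly_below \<open>z \<noteq> 0\<close> by blast
    have q0: "0 \<le> peval q r"
      by (rule peval_nonneg[OF assms(1)])
    then have "0 < 1 / (peval q r + 1)"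
      by simp
    then obtain p w m where w: "w \<noteq> 0" "0 < m" "peval p r \<le> 1 / (peval q r + 1) * real m"
      "ge (of_nat m * w * (of_nat k * z * x + (z + z)) + peval p u * w) (of_nat m * w * (of_nat k * z * y))"
      by (rule asymp_geE[OF close])
    have "ge (of_nat m * w * (of_nat k * z * x + (z + z)) + peval p u * w * (peval q u * z))
        (of_nat m * w * (of_nat k * z * x + (z + z)) + peval p u * w)"
      using ge_mult_left[OF q] by (intro ge_add_mono) auto
    also have "ge \<dots> (of_nat m * w * (of_nat k * z * y))"
      by (rule w)
    finally have "ge (of_nat (m * k) * (w * z) * x + peval ([:m + m:] + p * q) u * (w * z))
        (of_nat (m * k) * (w * z) * y)"
      by (simp add: algebra_simps)
    moreover have "peval ([:m + m:] + p * q) r \<le> \<epsilon> * real (m * k)"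
    proof -
      have "peval p r * peval q r \<le> peval p r * (peval q r + 1)"
        using peval_nonneg[OF assms(1), of p] by (simp add: algebra_simps)
      also have "\<dots> \<le> 1 / (peval q r + 1) * real m * (peval q r + 1)"
        using w(3) q0 by (intro mult_right_mono) auto
      also have "\<dots> = real m"
        using q0 by simp
      finally have "peval ([:m + m:] + p * q) r \<le> real m * 3"
        by simp
      also have "\<dots> \<le> real m * (\<epsilon> * real k)"
        using k3 by (intro mult_left_mono) auto
      finally show ?thesis
        by (simp add: ac_simps)
    qed
    moreover have "0 < m * k"
      using w(2) \<open>0 < k\<close> by simp
    ultimately show False
      using no mult_nonzero[OF w(1) \<open>z \<noteq> 0\<close>] by blast
  qed
  ultimately show ?thesis
    by (rule that)
qed

text \<open>Otherwise some homomorphism monotone for the asymptotic preorder separates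
  \<open>x\<close> from \<open>y\<close>; it is also monotone for the smaller relation
  \<open>ge\<close>.\<close>

lemma asymp_ge_if_homs:
  assumes "\<And>f. monotone_hom_Rplus ge f \<Longrightarrow> f y \<le> f x" "0 \<le> r"
  shows "asymp_ge r x y"
proof (rule ccontr)
  assume "\<not> asymp_ge r x y"
  then obtain k where k: "0 < k"
    "\<And>z. z \<noteq> 0 \<Longrightarrow> \<not> asymp_ge r (of_nat k * z * x + (z + z)) (of_nat k * z * y)"
    using asymp_ge_closed[OF assms(2)] by blast
  obtain f where f: "monotone_hom_Rplus (asymp_ge r) f" "f x < f y"
    using archimedean_preorder.exists_separating_hom[OF archimedean_preorder_asymp_ge[OF assms(2)] k]
    by blast
  have "monotone_hom_Rplus ge f"
    using f(1) asymp_ge_extends by (auto simp: monotone_hom_Rplus_def)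
  then show False
    using assms(1) f(2) by fastforce
qed

section \<open>From additive errors to factors and powers\<close>

text \<open>Since q(u) x >= 1, the additive error p(u) z is at most p(u) q(u) z x, so m + p q is the
  new polynomial.\<close>

lemma multiplicative_if_asymp_ge:
  assumes "0 \<le> r" "asymp_ge r x y" "x \<noteq> 0" "0 < \<epsilon>"
  shows "\<exists>p z m. z \<noteq> 0 \<and> 0 < m \<and> peval p r \<le> (1 + \<epsilon>) * real m \<and>
    ge (peval p u * z * x) (of_nat m * z * y)"
proof -
  obtain q where q: "ge (peval q u * x) 1"
    using poly_below assms(3) by blast
  have q0: "0 \<le> peval q r"
    by (rule peval_nonneg[OF assms(1)])
  with assms(4) have "0 < \<epsilon> / (peval q r + 1)"
    by simp
  then obtain p z m where 1: "z \<noteq> 0" "0 < m" "peval p r \<le> \<epsilon> / (peval q r + 1) * real m"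
    "ge (of_nat m * z * x + peval p u * z) (of_nat m * z * y)"
    by (rule asymp_geE[OF assms(2)])
  have "ge (of_nat m * z * x + peval p u * z * (peval q u * x)) (of_nat m * z * x + peval p u * z)"
    using ge_mult_left[OF q] by (intro ge_add_mono) auto
  also have "ge \<dots> (of_nat m * z * y)"
    by (rule 1)
  finally have "ge (peval ([:m:] + p * q) u * z * x) (of_nat m * z * y)"
    by (simp add: algebra_simps)
  moreover have "peval ([:m:] + p * q) r \<le> (1 + \<epsilon>) * real m"
  proof -
    have "peval p r * peval q r \<le> peval p r * (peval q r + 1)"
      using peval_nonneg[OF assms(1), of p] by (simp add: algebra_simps)
    also have "\<dots> \<le> \<epsilon> / (peval q r + 1) * real m * (peval q r + 1)"
      using 1(3) q0 by (intro mult_right_mono) auto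
    also have "\<dots> = \<epsilon> * real m"
      using q0 by simp
    finally show ?thesis
      by (simp add: algebra_simps)
  qed
  ultimately show ?thesis
    using 1 by blast
qed

text \<open>Iteration raises \<open>p\<close> and \<open>m\<close> to the power \<open>n\<close>
  while keeping a single \<open>z\<close>. Bounding \<open>z\<close> above by q(u) and cancelling it
  with q'(u) z >= 1 costs the factor q(r) q'(r), which does not depend on \<open>n\<close> and is
  absorbed by the n-th power of (1 + \<epsilon>)/(1 + \<epsilon>/2).\<close>

lemma powers_if_multiplicative:
  assumes "0 \<le> r" "0 < \<epsilon>"
    and z: "z \<noteq> 0" "0 < m" "peval p r \<le> (1 + \<epsilon> / 2) * real m" "ge (peval p u * z * x) (of_nat m * z * y)"
  shows "\<exists>p n m. 0 < n \<and> 0 < m \<and> peval p r \<le> (1 + \<epsilon>) ^ n * real m \<and>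
    ge (peval p u * x ^ n) (of_nat m * y ^ n)"
proof -
  have iterate: "ge (peval p u ^ n * z * x ^ n) (of_nat m ^ n * z * y ^ n)" for n
  proof (induction n)
    case (Suc n)
    have "ge (peval p u * x * (peval p u ^ n * z * x ^ n)) (peval p u * x * (of_nat m ^ n * z * y ^ n))"
      by (rule ge_mult_left[OF Suc])
    also have "\<dots> = of_nat m ^ n * y ^ n * (peval p u * z * x)"
      by (simp add: ac_simps)
    also have "ge \<dots> (of_nat m ^ n * y ^ n * (of_nat m * z * y))"
      by (rule ge_mult_left[OF z(4)])
    finally show ?case
      by (simp add: ac_simps)
  qed simp
  obtain q where q: "ge (peval q u) z"
    using poly_above by blast
  obtain q' where q': "ge (peval q' u * z) 1"
    using poly_below z(1) by blast
  define C where "C = peval q r * peval q' r"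
  have "1 < (1 + \<epsilon>) / (1 + \<epsilon> / 2)"
    using assms(2) by (simp add: field_simps)
  then obtain n0 where n0: "C < ((1 + \<epsilon>) / (1 + \<epsilon> / 2)) ^ n0"
    using real_arch_pow by blast
  define n where "n = Suc n0"
  have "((1 + \<epsilon>) / (1 + \<epsilon> / 2)) ^ n0 \<le> ((1 + \<epsilon>) / (1 + \<epsilon> / 2)) ^ n"
    unfolding n_def using \<open>1 < (1 + \<epsilon>) / (1 + \<epsilon> / 2)\<close> by (intro power_increasing) auto
  with n0 have "C \<le> (1 + \<epsilon>) ^ n / (1 + \<epsilon> / 2) ^ n"
    unfolding power_divide by linarith
  moreover have "0 < (1 + \<epsilon> / 2) ^ n"
    using assms(2) by simp
  ultimately have C: "C * (1 + \<epsilon> / 2) ^ n \<le> (1 + \<epsilon>) ^ n"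
    by (simp only: pos_le_divide_eq)
  have "peval p r ^ n \<le> ((1 + \<epsilon> / 2) * real m) ^ n"
    using z(3) peval_nonneg[OF assms(1)] by (rule power_mono)
  moreover have "0 \<le> C"
    unfolding C_def using peval_nonneg[OF assms(1)] by (intro mult_nonneg_nonneg)
  ultimately have "C * peval p r ^ n \<le> C * ((1 + \<epsilon> / 2) * real m) ^ n"
    by (intro mult_left_mono)
  also have "\<dots> = C * (1 + \<epsilon> / 2) ^ n * real m ^ n"
    by (simp add: power_mult_distrib)
  also have "\<dots> \<le> (1 + \<epsilon>) ^ n * real m ^ n"
    by (intro mult_right_mono) (use C in auto)
  finally have small: "peval (q * q' * p ^ n) r \<le> (1 + \<epsilon>) ^ n * real (m ^ n)"
    by (simp add: C_def)
  have "ge (peval q u * (peval q' u * peval p u ^ n * x ^ n)) (z * (peval q' u * peval p u ^ n * x ^ n))"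
    by (rule ge_mult_right[OF q])
  also have "\<dots> = peval q' u * (peval p u ^ n * z * x ^ n)"
    by (simp add: ac_simps)
  also have "ge \<dots> (peval q' u * (of_nat m ^ n * z * y ^ n))"
    by (rule ge_mult_left[OF iterate])
  also have "\<dots> = of_nat m ^ n * y ^ n * (peval q' u * z)"
    by (simp add: ac_simps)
  also have "ge \<dots> (of_nat m ^ n * y ^ n * 1)"
    by (rule ge_mult_left[OF q'])
  finally have "ge (peval (q * q' * p ^ n) u * x ^ n) (of_nat (m ^ n) * y ^ n)"
    by (simp add: ac_simps)
  moreover have "0 < n" "0 < m ^ n"
    using z(2) by (simp_all add: n_def)
  ultimately show ?thesis
    using small by blast
qed

section \<open>From the inequalities back to homomorphisms\<close>

text \<open>Applying \<open>f\<close> to p(u) z >= 1 shows that f(z) cannot vanish; this allows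
  cancelling the catalyst.\<close>

lemma hom_pos:
  assumes "monotone_hom_Rplus ge f" "z \<noteq> 0"
  shows "0 < f z"
proof -
  obtain p where "ge (peval p u * z) 1"
    using poly_below assms(2) by blast
  then have "1 \<le> f (peval p u) * f z"
    using monotone_hom_mono[OF assms(1)] by (fastforce simp: monotone_hom_eval(2,4)[OF assms(1)])
  then have "f z \<noteq> 0"
    by auto
  then show ?thesis
    using monotone_hom_nonneg[OF assms(1), of z] by simp
qed

lemma hom_le_if_additive:
  assumes f: "monotone_hom_Rplus ge f" and z: "z \<noteq> 0" "0 < m"
    and "peval p (f u) \<le> \<epsilon> * real m" "ge (of_nat m * z * x + peval p u * z) (of_nat m * z * y)"
  shows "f y \<le> f x + \<epsilon>"
proof -
  have "(real m * f z) * f y \<le> (real m * f z) * f x + peval p (f u) * f z"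
    using monotone_hom_mono[OF f assms(5)] by (simp add: monotone_hom_eval[OF f])
  also have "\<dots> \<le> (real m * f z) * f x + (\<epsilon> * real m) * f z"
    using assms(4) hom_pos[OF f z(1)] by (intro add_left_mono mult_right_mono) auto
  also have "\<dots> = (real m * f z) * (f x + \<epsilon>)"
    by (simp add: algebra_simps)
  finally show ?thesis
    using z(2) hom_pos[OF f z(1)] by (subst (asm) mult_le_cancel_left_pos) auto
qed

lemma hom_le_if_multiplicative:
  assumes f: "monotone_hom_Rplus ge f" and z: "z \<noteq> 0" "0 < m"
    and "peval p (f u) \<le> (1 + \<epsilon>) * real m" "ge (peval p u * z * x) (of_nat m * z * y)"
  shows "f y \<le> (1 + \<epsilon>) * f x"
proof -
  have "(real m * f z) * f y \<le> peval p (f u) * (f z * f x)"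
    using monotone_hom_mono[OF f assms(5)] by (simp add: monotone_hom_eval[OF f] ac_simps)
  also have "\<dots> \<le> ((1 + \<epsilon>) * real m) * (f z * f x)"
    using assms(4) monotone_hom_nonneg[OF f] by (intro mult_right_mono) auto
  also have "\<dots> = (real m * f z) * ((1 + \<epsilon>) * f x)"
    by (simp add: algebra_simps)
  finally show ?thesis
    using z(2) hom_pos[OF f z(1)] by (subst (asm) mult_le_cancel_left_pos) auto
qed

text \<open>After applying \<open>f\<close> and cancelling \<open>m\<close>, an n-th root is taken
  of nonnegative reals.\<close>

lemma hom_le_if_powers:
  assumes f: "monotone_hom_Rplus ge f" and "0 < n" "0 < m" "0 \<le> \<epsilon>"
    and "peval p (f u) \<le> (1 + \<epsilon>) ^ n * real m" "ge (peval p u * x ^ n) (of_nat m * y ^ n)"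
  shows "f y \<le> (1 + \<epsilon>) * f x"
proof -
  have "real m * f y ^ n \<le> peval p (f u) * f x ^ n"
    using monotone_hom_mono[OF f assms(6)] by (simp add: monotone_hom_eval[OF f])
  also have "\<dots> \<le> ((1 + \<epsilon>) ^ n * real m) * f x ^ n"
    using assms(5) monotone_hom_nonneg[OF f] by (intro mult_right_mono) auto
  also have "\<dots> = real m * ((1 + \<epsilon>) * f x) ^ n"
    by (simp add: power_mult_distrib)
  finally have "f y ^ n \<le> ((1 + \<epsilon>) * f x) ^ n"
    using assms(3) by simp
  then show ?thesis
    using assms(2,4) monotone_hom_nonneg[OF f] by (subst (asm) power_mono_iff) auto
qed

end

lemma le_if_le_mult_one_plus:
  fixes a b :: real
  assumes "0 < a" "\<And>\<epsilon>. 0 < \<epsilon> \<Longrightarrow> b \<le> (1 + \<epsilon>) * a"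
  shows "b \<le> a"
proof (rule field_le_epsilon)
  fix \<epsilon> :: real
  assume "0 < \<epsilon>"
  then have "b \<le> (1 + \<epsilon> / a) * a"
    using assms(1) by (intro assms(2)) simp
  then show "b \<le> a + \<epsilon>"
    using assms(1) by (simp add: algebra_simps)
qed

theorem theorem2p12:
  fixes ge :: "'a::comm_semiring_1 \<Rightarrow> 'a \<Rightarrow> bool" and u x y :: 'a
  assumes "preordered_semiring ge"
    and "char_zero_semiring TYPE('a)"
    and "ge 1 0"
    and "poly_universal ge u"
    and "x \<noteq> 0" and "y \<noteq> 0"
  shows
   "let C1 = (\<forall>f. monotone_hom_Rplus ge f \<longrightarrow> f x \<ge> f y);
        C2 = (\<forall>r::real. \<forall>\<epsilon>::real. r \<ge> 0 \<longrightarrow> \<epsilon> > 0 \<longrightarrow>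
               (\<exists>(p::nat poly) (z::'a) (m::nat). z \<noteq> 0 \<and> m > 0 \<and>
                  poly (map_poly real p) r \<le> \<epsilon> * real m \<and>
                  ge (of_nat m * z * x + peval p u * z) (of_nat m * z * y)));
        C3 = (\<forall>r::real. \<forall>\<epsilon>::real. r \<ge> 0 \<longrightarrow> \<epsilon> > 0 \<longrightarrow>
               (\<exists>(p::nat poly) (z::'a) (m::nat). z \<noteq> 0 \<and> m > 0 \<and>
                  poly (map_poly real p) r \<le> (1 + \<epsilon>) * real m \<and>
                  ge (peval p u * z * x) (of_nat m * z * y)));
        C4 = (\<forall>r::real. \<forall>\<epsilon>::real. r \<ge> 0 \<longrightarrow> \<epsilon> > 0 \<longrightarrow>
               (\<exists>(p::nat poly) (n::nat) (m::nat). n > 0 \<and> m > 0 \<and>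
                  poly (map_poly real p) r \<le> (1 + \<epsilon>) ^ n * real m \<and>
                  ge (peval p u * x ^ n) (of_nat m * y ^ n)))
    in (C1 \<longleftrightarrow> C2) \<and> (C1 \<longleftrightarrow> C3) \<and> (C1 \<longleftrightarrow> C4)"
proof -
  interpret nonneg_preorder ge
    using assms(1,3) by unfold_locales
  let ?C1 = "\<forall>f. monotone_hom_Rplus ge f \<longrightarrow> f x \<ge> f y"
  let ?C2 = "\<forall>r::real. \<forall>\<epsilon>::real. r \<ge> 0 \<longrightarrow> \<epsilon> > 0 \<longrightarrow>
    (\<exists>(p::nat poly) (z::'a) (m::nat). z \<noteq> 0 \<and> m > 0 \<and> peval p r \<le> \<epsilon> * real m \<and>
       ge (of_nat m * z * x + peval p u * z) (of_nat m * z * y))"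
  let ?C3 = "\<forall>r::real. \<forall>\<epsilon>::real. r \<ge> 0 \<longrightarrow> \<epsilon> > 0 \<longrightarrow>
    (\<exists>(p::nat poly) (z::'a) (m::nat). z \<noteq> 0 \<and> m > 0 \<and> peval p r \<le> (1 + \<epsilon>) * real m \<and>
       ge (peval p u * z * x) (of_nat m * z * y))"
  let ?C4 = "\<forall>r::real. \<forall>\<epsilon>::real. r \<ge> 0 \<longrightarrow> \<epsilon> > 0 \<longrightarrow>
    (\<exists>(p::nat poly) (n::nat) (m::nat). n > 0 \<and> m > 0 \<and> peval p r \<le> (1 + \<epsilon>) ^ n * real m \<and>
       ge (peval p u * x ^ n) (of_nat m * y ^ n))"
  have "(?C1 \<longleftrightarrow> ?C2) \<and> (?C1 \<longleftrightarrow> ?C3) \<and> (?C1 \<longleftrightarrow> ?C4)"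
  proof (cases "ge 0 1")
    case True
    have all: "ge a b" for a b
    proof -
      have "ge (0 * b) (1 * b)"
        by (rule ge_mult_right[OF True])
      then show ?thesis
        using ge_trans[OF ge_0] by simp
    qed
    \<comment> \<open>A monotone homomorphism would give 0 = f(0) >= f(1) = 1. The first condition
      is thus vacuous, and the others hold with p = 0 because all inequalities hold.\<close>
    have "\<not> monotone_hom_Rplus ge f" for f
      using True monotone_hom_mono[of ge f 0 1] monotone_hom_eval(1,2)[of ge f] by force
    moreover have ?C2 ?C3 ?C4
      using all by (auto intro!: exI[of _ "0 :: nat poly"] exI[of _ "1 :: 'a"] exI[of _ "1 :: nat"])
    ultimately show ?thesis
      by blast
  next
    case False
    interpret poly_universal_preorder ge u
      using assms(4) False by unfold_locales
    have 12: ?C2 if ?C1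
      using asymp_ge_if_homs that by (simp add: asymp_ge_def)
    have 23: ?C3 if ?C2
      using that multiplicative_if_asymp_ge[OF _ _ assms(5)] by (simp add: asymp_ge_def)
    have 34: ?C4 if C3: ?C3
    proof (intro allI impI)
      fix r \<epsilon> :: real
      assume r: "0 \<le> r" and \<epsilon>: "0 < \<epsilon>"
      then have "0 < \<epsilon> / 2"
        by simp
      then obtain p z m where "z \<noteq> 0" "0 < m" "peval p r \<le> (1 + \<epsilon> / 2) * real m"
        "ge (peval p u * z * x) (of_nat m * z * y)"
        using C3 r by blast
      then show "\<exists>p n m. 0 < n \<and> 0 < m \<and> peval p r \<le> (1 + \<epsilon>) ^ n * real m \<and>
          ge (peval p u * x ^ n) (of_nat m * y ^ n)"
        by (rule powers_if_multiplicative[OF r \<epsilon>])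
    qed
    \<comment> \<open>In this and the next two steps the conditions are used at r = f(u), so that
      p(r) is the image of p(u) under \<open>f\<close>.\<close>
    have 21: "f y \<le> f x" if C2: ?C2 and f: "monotone_hom_Rplus ge f" for f
    proof (rule field_le_epsilon)
      fix \<epsilon> :: real
      assume "0 < \<epsilon>"
      then obtain p z m where "z \<noteq> 0" "0 < m" "peval p (f u) \<le> \<epsilon> * real m"
        "ge (of_nat m * z * x + peval p u * z) (of_nat m * z * y)"
        using C2 monotone_hom_nonneg[OF f] by blast
      then show "f y \<le> f x + \<epsilon>"
        by (rule hom_le_if_additive[OF f])
    qed
    have 31: "f y \<le> f x" if C3: ?C3 and f: "monotone_hom_Rplus ge f" for f
    proof (rule le_if_le_mult_one_plus[OF hom_pos[OF f assms(5)]])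
      fix \<epsilon> :: real
      assume "0 < \<epsilon>"
      then obtain p z m where "z \<noteq> 0" "0 < m" "peval p (f u) \<le> (1 + \<epsilon>) * real m"
        "ge (peval p u * z * x) (of_nat m * z * y)"
        using C3 monotone_hom_nonneg[OF f] by blast
      then show "f y \<le> (1 + \<epsilon>) * f x"
        by (rule hom_le_if_multiplicative[OF f])
    qed
    have 41: "f y \<le> f x" if C4: ?C4 and f: "monotone_hom_Rplus ge f" for f
    proof (rule le_if_le_mult_one_plus[OF hom_pos[OF f assms(5)]])
      fix \<epsilon> :: real
      assume \<epsilon>: "0 < \<epsilon>"
      then obtain p n m where "0 < n" "0 < m" "peval p (f u) \<le> (1 + \<epsilon>) ^ n * real m"
        "ge (peval p u * x ^ n) (of_nat m * y ^ n)"
        using C4 monotone_hom_nonneg[OF f] by blast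
      then show "f y \<le> (1 + \<epsilon>) * f x"
        using hom_le_if_powers[OF f] \<epsilon> by simp
    qed
    have ?C1 if ?C2
      using 21[OF that] by blast
    moreover have ?C1 if ?C3
      using 31[OF that] by blast
    moreover have ?C1 if ?C4
      using 41[OF that] by blast
    ultimately show ?thesis
      using 12 23 34 by argo
  qed
  then show ?thesis
    unfolding Let_def peval_def[of _ "_ :: real", symmetric] .
qed

end
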